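(* Let $\theta\in\mathbb{S}^n$, let $r_j\ge 0$ for all $j\in\mathcal{N}=\{1,\dots,n\}$, and let $\mathcal{H}\subseteq\mathcal{N}$ induce an isolated subgraph in the graphical representation of the Ising model with parameters $\theta$ (that is, $\theta_{ij}=0$ for all $i\in\mathcal{H}$, $j\in\mathcal{N}\setminus\mathcal{H}$). If this subgraph contains no edges with negative weights, i.e. $\theta_{ij}\ge 0$ for all $i,j\in\mathcal{H}$ with $i\ne j$, then all products of $\mathcal{H}$ belong to the optimal assortment: there is an optimal solution $S^*$ of $\max_{S\subseteq\mathcal{N}}R(S)$ with $\mathcal{H}\subseteq S^*$.
   Context: Let $\mathcal{N}=\{1,\dots,n\}$ be a set of products and $\theta\in\mathbb{S}^n$ a real symmetric $n\times n$ matrix. An assortment is a subset $S\subseteq\mathcal{N}$; a basket from $S$ is a vector $x\in\mathcal{X}(S)=\{0,1\}^{S}$. Under the (binary) Ising model with parameters $\theta$, the probability that a random customer offered $S$ selects basket $x$ is $$p_\theta(x\mid S)=\frac{\exp\bigl(\sum_{i\in S}\theta_{ii}x_i+\sum_{i\ne j,\ i,j\in S}x_i\theta_{ij}x_j\bigr)}{\sum_{y\in\mathcal{X}(S)}\exp\bigl(\sum_{i\in S}\theta_{ii}y_i+\sum_{i\ne j,\ i,j\in S}y_i\theta_{ij}y_j\bigr)},$$ where the sum over $i\ne j$ runs over ordered pairs. With $r_j$ the gross profit (or revenue) per unit of product $j$, the expected profit of assortment $S$ is $R(S)=\sum_{x\in\mathcal{X}(S)}p_\theta(x\mid S)\sum_{j\in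 S}r_jx_j$. The graphical representation of the model is the weighted graph on $\mathcal{N}$ in which distinct $i,j$ are joined by an edge of weight $\theta_{ij}$ iff $\theta_{ij}\ne 0$. *)

theory Defs
  imports "HOL-Analysis.Analysis"
begin

text \<open>The products are the elements of a finite type \<open>'n\<close>, so the ground set of all products is
  \<open>UNIV\<close> and every \<open>S :: 'n set\<close> is an assortment.\<close>

text \<open>Vectors indexed by \<open>S\<close> are extensional functions: coordinates outside \<open>S\<close> carry no
  information, so there are exactly \<open>2 ^ card S\<close> baskets.\<close>

definition baskets :: "'n::finite set \<Rightarrow> ('n \<Rightarrow> real) set" where
  "baskets S = (S \<rightarrow>\<^sub>E {0, 1})"

text \<open>The interaction sum runs over ordered pairs, so each unordered pair contributes twice when
  \<open>\<theta>\<close> is symmetric.\<close>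

definition ising_exponent :: "real^'n^'n \<Rightarrow> 'n::finite set \<Rightarrow> ('n \<Rightarrow> real) \<Rightarrow> real" where
  "ising_exponent \<theta> S x =
     (\<Sum>i\<in>S. \<theta> $ i $ i * x i) + (\<Sum>i\<in>S. \<Sum>j\<in>S - {i}. x i * \<theta> $ i $ j * x j)"

definition ising_prob :: "real^'n^'n \<Rightarrow> 'n::finite set \<Rightarrow> ('n \<Rightarrow> real) \<Rightarrow> real" where
  "ising_prob \<theta> S x =
     exp (ising_exponent \<theta> S x) / (\<Sum>y\<in>baskets S. exp (ising_exponent \<theta> S y))"

definition expected_profit :: "real^'n^'n \<Rightarrow> real^'n \<Rightarrow> 'n::finite set \<Rightarrow> real" where
  "expected_profit \<theta> r S = (\<Sum>x\<in>baskets S. ising_prob \<theta> S x * (\<Sum>j\<in>S. r $ j * x j))"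

definition optimal_assortment :: "real^'n^'n \<Rightarrow> real^'n \<Rightarrow> 'n::finite set \<Rightarrow> bool" where
  "optimal_assortment \<theta> r S \<longleftrightarrow> (\<forall>T. expected_profit \<theta> r T \<le> expected_profit \<theta> r S)"

text \<open>Adjacency in the weighted graph of the model; the weight of the edge between \<open>i\<close> and \<open>j\<close>
  is \<open>\<theta> $ i $ j\<close>.\<close>

definition ising_adj :: "real^'n^'n \<Rightarrow> 'n::finite \<Rightarrow> 'n \<Rightarrow> bool" where
  "ising_adj \<theta> i j \<longleftrightarrow> i \<noteq> j \<and> \<theta> $ i $ j \<noteq> 0"

text \<open>Isolated means that no edge leaves \<open>H\<close>; \<open>H\<close> need not be connected.\<close>

definition isolated_subgraph :: "real^'n^'n \<Rightarrow> 'n::finite set \<Rightarrow> bool" where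
  "isolated_subgraph \<theta> H \<longleftrightarrow> (\<forall>i\<in>H. \<forall>j\<in>-H. \<not> ising_adj \<theta> i j)"

definition no_negative_edges :: "real^'n^'n \<Rightarrow> 'n::finite set \<Rightarrow> bool" where
  "no_negative_edges \<theta> H \<longleftrightarrow> (\<forall>i\<in>H. \<forall>j\<in>H. ising_adj \<theta> i j \<longrightarrow> \<theta> $ i $ j \<ge> 0)"

lemma isolated_subgraph_iff:
  "isolated_subgraph \<theta> H \<longleftrightarrow> (\<forall>i\<in>H. \<forall>j\<in>-H. \<theta> $ i $ j = 0)"
  by (metis ComplD isolated_subgraph_def ising_adj_def)

lemma no_negative_edges_iff:
  "no_negative_edges \<theta> H \<longleftrightarrow> (\<forall>i\<in>H. \<forall>j\<in>H. i \<noteq> j \<longrightarrow> \<theta> $ i $ j \<ge> 0)"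
  by (force simp: no_negative_edges_def ising_adj_def)

end

theory Submission
  imports Defs
begin

text \<open>
  Since \<open>x\<^sub>i\<close> is 0 or 1, a basket is a set \<open>A \<subseteq> S\<close> of bought products, and its
  weight is \<open>w(A) = exp (\<Sum>i\<in>A. \<Sum>j\<in>A. \<theta>\<^sub>i\<^sub>j)\<close>: the diagonal terms of the double sum are the
  linear terms of the exponent. So \<open>R(S)\<close> is the mean of the modular function \<open>\<Sum>j\<in>A. r\<^sub>j\<close>
  under the weights \<open>w\<close> on the subsets of \<open>S\<close>.

  No interaction crosses the boundary of \<open>H\<close>, so the parts of the basket inside and outside \<open>H\<close>
  are independent, and \<open>R(T) = R(T \<inter> H) + R(T - H)\<close> for every assortment \<open>T\<close>
  (\<open>expected_profit_Un\<close>). Starting from an optimal \<open>T\<close>, it therefore suffices that replacing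
  \<open>T \<inter> H\<close> by \<open>H\<close> does not lower the first term.

  On \<open>H\<close> all off-diagonal \<open>\<theta>\<^sub>i\<^sub>j\<close> are nonnegative, which makes \<open>w\<close> log-supermodular: products
  only attract each other. Offering \<open>P\<close> instead of \<open>S \<supseteq> P\<close> amounts to conditioning on buying nothing
  from \<open>S - P\<close>, which under positive association lowers the mean of every increasing function.
  This last fact, in the form \<open>expected_profit_mono\<close>, is one application of the
  Ahlswede--Daykin inequality \<open>four_functions\<close>.
\<close>

section \<open>The four functions theorem\<close>

text \<open>The case of a one-element ground set. With \<open>X = a0 * b1\<close>, \<open>Y = a1 * b0\<close> and \<open>Z = c1 * d0\<close>, both
  \<open>X\<close> and \<open>Y\<close> are at most \<open>Z\<close>, so \<open>(Z - X) * (Z - Y) \<ge> 0\<close>; dividing by \<open>Z\<close> gives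
  \<open>X + Y \<le> Z + X * Y / Z\<close>, and \<open>X * Y\<close> is bounded by the product of the two pure hypotheses.\<close>

lemma four_functions_singleton:
  fixes a0 a1 b0 b1 c0 c1 d0 d1 :: real
  assumes nonneg: "0 \<le> a0" "0 \<le> a1" "0 \<le> b0" "0 \<le> b1" "0 \<le> c0" "0 \<le> c1" "0 \<le> d0" "0 \<le> d1"
    and le00: "a0 * b0 \<le> c0 * d0" and le01: "a0 * b1 \<le> c1 * d0"
    and le10: "a1 * b0 \<le> c1 * d0" and le11: "a1 * b1 \<le> c1 * d1"
  shows "(a0 + a1) * (b0 + b1) \<le> (c0 + c1) * (d0 + d1)"
proof -
  define X Y Z where XYZ: "X = a0 * b1" "Y = a1 * b0" "Z = c1 * d0"
  have X: "0 \<le> X" "X \<le> Z" and Y: "0 \<le> Y" "Y \<le> Z"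
    using assms by (auto simp: XYZ)
  have "X + Y \<le> Z + c0 * d1"
  proof (cases "Z = 0")
    case True
    then show ?thesis using X Y nonneg by simp
  next
    case False
    then have Z: "Z > 0" using X by linarith
    have "X * Y \<le> Z * (c0 * d1)"
      using mult_mono[OF le00 le11] nonneg by (simp add: XYZ mult_ac)
    moreover have "0 \<le> (Z - X) * (Z - Y)" using X Y by simp
    ultimately have "Z * (X + Y) \<le> Z * (Z + c0 * d1)"
      by (simp add: algebra_simps)
    then show ?thesis using Z by simp
  qed
  then show ?thesis using le00 le11 by (simp add: XYZ algebra_simps)
qed

lemma sum_Pow_insert:
  fixes f :: "'a set \<Rightarrow> real"
  assumes "finite S" "k \<notin> S"
  shows "(\<Sum>A\<in>Pow (insert k S). f A) = (\<Sum>A\<in>Pow S. f A + f (insert k A))"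
proof -
  have "inj_on (insert k) (Pow S)"
    using assms by (intro inj_onI) (metis PowD insert_ident subsetD)
  moreover have "Pow S \<inter> insert k ` Pow S = {}" using assms by auto
  ultimately show ?thesis
    using assms by (simp add: Pow_insert sum.union_disjoint sum.reindex sum.distrib)
qed

text \<open>Summing out one element \<open>k\<close> replaces each function by its sum over the presence and
  absence of \<open>k\<close>. The singleton case says that the hypothesis survives this step, so the
  induction hypothesis applies to the four new functions.\<close>

theorem four_functions:
  fixes \<alpha> \<beta> \<gamma> \<delta> :: "'a set \<Rightarrow> real"
  assumes "finite S"
    and "\<And>A. A \<subseteq> S \<Longrightarrow> 0 \<le> \<alpha> A" "\<And>A. A \<subseteq> S \<Longrightarrow> 0 \<le> \<beta> A"
    and "\<And>A. A \<subseteq> S \<Longrightarrow> 0 \<le> \<gamma> A" "\<And>A. A \<subseteq> S \<Longrightarrow> 0 \<le> \<delta> A"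
    and "\<And>A B. A \<subseteq> S \<Longrightarrow> B \<subseteq> S \<Longrightarrow> \<alpha> A * \<beta> B \<le> \<gamma> (A \<union> B) * \<delta> (A \<inter> B)"
  shows "(\<Sum>A\<in>Pow S. \<alpha> A) * (\<Sum>A\<in>Pow S. \<beta> A) \<le> (\<Sum>A\<in>Pow S. \<gamma> A) * (\<Sum>A\<in>Pow S. \<delta> A)"
  using assms
proof (induction S arbitrary: \<alpha> \<beta> \<gamma> \<delta> rule: finite_induct)
  case empty
  from empty(5)[of "{}" "{}"] show ?case by simp
next
  case (insert k S)
  note nonneg = insert.prems(1-4) and le = insert.prems(5)
  have "(\<alpha> A + \<alpha> (insert k A)) * (\<beta> B + \<beta> (insert k B))
      \<le> (\<gamma> (A \<union> B) + \<gamma> (insert k (A \<union> B))) * (\<delta> (A \<inter> B) + \<delta> (insert k (A \<inter> B)))"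
    if AB: "A \<subseteq> S" "B \<subseteq> S" for A B
  proof (rule four_functions_singleton)
    have k: "k \<notin> A" "k \<notin> B" using AB insert.hyps by auto
    have sub: "A \<subseteq> insert k S" "insert k A \<subseteq> insert k S"
      "B \<subseteq> insert k S" "insert k B \<subseteq> insert k S" using AB by auto
    show "\<alpha> A * \<beta> B \<le> \<gamma> (A \<union> B) * \<delta> (A \<inter> B)"
      using le[OF sub(1,3)] .
    show "\<alpha> A * \<beta> (insert k B) \<le> \<gamma> (insert k (A \<union> B)) * \<delta> (A \<inter> B)"
      using le[OF sub(1,4)] k by simp
    show "\<alpha> (insert k A) * \<beta> B \<le> \<gamma> (insert k (A \<union> B)) * \<delta> (A \<inter> B)"
      using le[OF sub(2,3)] k by simp
    show "\<alpha> (insert k A) * \<beta> (insert k B) \<le> \<gamma> (insert k (A \<union> B)) * \<delta> (insert k (A \<inter> B))"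
      using le[OF sub(2,4)] by simp
  qed (use AB in \<open>auto intro!: nonneg\<close>)
  then have "(\<Sum>A\<in>Pow S. \<alpha> A + \<alpha> (insert k A)) * (\<Sum>A\<in>Pow S. \<beta> A + \<beta> (insert k A))
      \<le> (\<Sum>A\<in>Pow S. \<gamma> A + \<gamma> (insert k A)) * (\<Sum>A\<in>Pow S. \<delta> A + \<delta> (insert k A))"
    by (intro insert.IH) (auto intro!: add_nonneg_nonneg nonneg)
  then show ?case by (simp only: sum_Pow_insert[OF insert.hyps])
qed

section \<open>Baskets as sets of bought products\<close>

definition set_weight :: "real^'n^'n \<Rightarrow> 'n::finite set \<Rightarrow> real" where
  "set_weight \<theta> A = exp (\<Sum>(i, j)\<in>A \<times> A. \<theta> $ i $ j)"

definition partition_function :: "real^'n^'n \<Rightarrow> 'n::finite set \<Rightarrow> real" where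
  "partition_function \<theta> S = (\<Sum>A\<in>Pow S. set_weight \<theta> A)"

definition weighted_profit :: "real^'n^'n \<Rightarrow> real^'n \<Rightarrow> 'n::finite set \<Rightarrow> real" where
  "weighted_profit \<theta> r S = (\<Sum>A\<in>Pow S. set_weight \<theta> A * (\<Sum>j\<in>A. r $ j))"

lemma set_weight_pos: "set_weight \<theta> A > 0"
  by (simp add: set_weight_def)

lemma partition_function_pos: "partition_function \<theta> S > 0"
  unfolding partition_function_def by (rule sum_pos) (auto simp: set_weight_pos)

lemma sum_baskets:
  "(\<Sum>x\<in>baskets S. f x) = (\<Sum>A\<in>Pow S. f (restrict (indicator A) S))"
proof (rule sum.reindex_bij_witness[where i = "\<lambda>A. restrict (indicator A) S"
      and j = "\<lambda>x. {i\<in>S. x i = 1}"])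
  fix x assume "x \<in> baskets S"
  then have x: "\<And>i. i \<in> S \<Longrightarrow> x i = 0 \<or> x i = 1" and undef: "\<And>i. i \<notin> S \<Longrightarrow> x i = undefined"
    by (auto simp: baskets_def PiE_def extensional_def)
  show restrict: "restrict (indicator {i\<in>S. x i = 1}) S = x"
    using x undef by (auto simp: fun_eq_iff indicator_def)
  show "f (restrict (indicator {i\<in>S. x i = 1}) S) = f x" by (simp only: restrict)
next
  fix A assume "A \<in> Pow S"
  then show "{i\<in>S. restrict (indicator A) S i = (1::real)} = A"
    by (auto simp: indicator_def)
qed (auto simp: baskets_def indicator_def)

lemma sum_mult_indicator_subset:
  fixes f :: "'a \<Rightarrow> real"
  assumes "finite S" "A \<subseteq> S"
  shows "(\<Sum>j\<in>S. f j * indicator A j) = (\<Sum>j\<in>A. f j)"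
  by (rule sum.mono_neutral_cong_right) (use assms in \<open>auto simp: indicator_def\<close>)

lemma ising_exponent_indicator:
  assumes "A \<subseteq> S"
  shows "exp (ising_exponent \<theta> S (restrict (indicator A) S)) = set_weight \<theta> A"
proof -
  let ?x = "indicator A :: _ \<Rightarrow> real"
  \<comment> \<open>The linear term is the missing diagonal term because \<open>x\<^sub>i\<^sup>2 = x\<^sub>i\<close>.\<close>
  have *: "\<theta> $ i $ i * ?x i + (\<Sum>j\<in>S - {i}. ?x i * \<theta> $ i $ j * ?x j)
      = (\<Sum>j\<in>S. ?x i * \<theta> $ i $ j * ?x j)" if "i \<in> S" for i
    using sum.remove[OF _ that, of "\<lambda>j. ?x i * \<theta> $ i $ j * ?x j"] by (simp add: indicator_def)
  have "ising_exponent \<theta> S (restrict ?x S)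
      = (\<Sum>i\<in>S. \<theta> $ i $ i * ?x i + (\<Sum>j\<in>S - {i}. ?x i * \<theta> $ i $ j * ?x j))"
    by (simp add: ising_exponent_def sum.distrib)
  also have "\<dots> = (\<Sum>i\<in>S. \<Sum>j\<in>S. ?x i * \<theta> $ i $ j * ?x j)"
    using * by (rule sum.cong[OF refl])
  also have "\<dots> = (\<Sum>i\<in>S. (\<Sum>j\<in>S. \<theta> $ i $ j * ?x j) * ?x i)"
    unfolding sum_distrib_right by (intro sum.cong refl) (simp only: mult_ac)
  also have "\<dots> = (\<Sum>i\<in>A. \<Sum>j\<in>A. \<theta> $ i $ j)"
    by (simp only: sum_mult_indicator_subset[OF finite assms])
  finally show ?thesis by (simp add: set_weight_def sum.cartesian_product)
qed

lemma expected_profit_eq: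
  "expected_profit \<theta> r S = weighted_profit \<theta> r S / partition_function \<theta> S"
proof -
  have profit: "(\<Sum>j\<in>S. r $ j * restrict (indicator A) S j) = (\<Sum>j\<in>A. r $ j)"
    if "A \<subseteq> S" for A
    using sum_mult_indicator_subset[OF finite that] by simp
  have Z: "(\<Sum>x\<in>baskets S. exp (ising_exponent \<theta> S x)) = partition_function \<theta> S"
    unfolding sum_baskets partition_function_def
    by (rule sum.cong) (auto simp: ising_exponent_indicator)
  show ?thesis
    unfolding expected_profit_def ising_prob_def Z
    unfolding weighted_profit_def sum_divide_distrib sum_baskets
    by (intro sum.cong refl)
      (simp only: Pow_iff ising_exponent_indicator profit times_divide_eq_left)
qed

section \<open>Additivity over non-interacting parts\<close>

lemma sum_Pow_Un:
  fixes f :: "'a set \<Rightarrow> real"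
  assumes "S \<inter> T = {}"
  shows "(\<Sum>C\<in>Pow (S \<union> T). f C) = (\<Sum>A\<in>Pow S. \<Sum>B\<in>Pow T. f (A \<union> B))"
  unfolding sum.cartesian_product
  by (rule sum.reindex_bij_witness[where j = "\<lambda>C. (C \<inter> S, C \<inter> T)" and i = "\<lambda>(A, B). A \<union> B"])
    (use assms in \<open>auto simp: Int_Un_distrib[symmetric] Int_absorb2\<close>)

lemma set_weight_Un:
  assumes "A \<inter> B = {}"
    and "\<And>i j. i \<in> A \<Longrightarrow> j \<in> B \<Longrightarrow> \<theta> $ i $ j = 0" "\<And>i j. i \<in> B \<Longrightarrow> j \<in> A \<Longrightarrow> \<theta> $ i $ j = 0"
  shows "set_weight \<theta> (A \<union> B) = set_weight \<theta> A * set_weight \<theta> B"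
proof -
  have "(\<Sum>(i, j)\<in>(A \<union> B) \<times> (A \<union> B). \<theta> $ i $ j) = (\<Sum>(i, j)\<in>A \<times> A \<union> B \<times> B. \<theta> $ i $ j)"
    by (rule sum.mono_neutral_right) (use assms in auto)
  also have "\<dots> = (\<Sum>(i, j)\<in>A \<times> A. \<theta> $ i $ j) + (\<Sum>(i, j)\<in>B \<times> B. \<theta> $ i $ j)"
    by (rule sum.union_disjoint) (use assms in auto)
  finally show ?thesis by (simp add: set_weight_def exp_add)
qed

text \<open>The weights factorize, so the two halves of a random basket are independent; the
  profit is a sum of a function of each half, whence its mean is the sum of the means.\<close>

lemma expected_profit_Un:
  assumes disj: "S \<inter> T = {}"
    and zero: "\<And>i j. i \<in> S \<Longrightarrow> j \<in> T \<Longrightarrow> \<theta> $ i $ j = 0" "\<And>i j. i \<in> T \<Longrightarrow> j \<in> S \<Longrightarrow> \<theta> $ i $ j = 0"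
  shows "expected_profit \<theta> r (S \<union> T) = expected_profit \<theta> r S + expected_profit \<theta> r T"
proof -
  have weight: "set_weight \<theta> (A \<union> B) = set_weight \<theta> A * set_weight \<theta> B"
    and profit: "(\<Sum>j\<in>A \<union> B. r $ j) = (\<Sum>j\<in>A. r $ j) + (\<Sum>j\<in>B. r $ j)"
    if "A \<in> Pow S" "B \<in> Pow T" for A B
    using that disj zero by (blast intro: set_weight_Un sum.union_disjoint finite)+
  have Z: "partition_function \<theta> (S \<union> T) = partition_function \<theta> S * partition_function \<theta> T"
    by (simp add: partition_function_def sum_Pow_Un[OF disj] sum_product weight
        cong: sum.cong_simp)
  have W: "weighted_profit \<theta> r (S \<union> T) = weighted_profit \<theta> r S * partition_function \<theta> T
      + partition_function \<theta> S * weighted_profit \<theta> r T"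
    unfolding weighted_profit_def partition_function_def sum_Pow_Un[OF disj] sum_product
      sum.distrib[symmetric]
    by (intro sum.cong refl) (simp only: weight profit, simp add: algebra_simps)
  show ?thesis
    using partition_function_pos[of \<theta> S] partition_function_pos[of \<theta> T]
    by (simp add: expected_profit_eq Z W field_simps)
qed

section \<open>Monotonicity under nonnegative interactions\<close>

text \<open>The index pairs counted in \<open>(A \<union> B) \<times> (A \<union> B)\<close> but in neither \<open>A \<times> A\<close> nor \<open>B \<times> B\<close> join
  \<open>A - B\<close> to \<open>B - A\<close>; they are off-diagonal, so their entries are nonnegative.\<close>

lemma set_weight_log_supermodular:
  assumes nonneg: "no_negative_edges \<theta> H" and sub: "A \<subseteq> H" "B \<subseteq> H"
  shows "set_weight \<theta> A * set_weight \<theta> B \<le> set_weight \<theta> (A \<union> B) * set_weight \<theta> (A \<inter> B)"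
proof -
  let ?t = "\<lambda>(i, j). \<theta> $ i $ j"
  have "sum ?t (A \<times> A) + sum ?t (B \<times> B) = sum ?t (A \<times> A \<union> B \<times> B) + sum ?t ((A \<times> A) \<inter> (B \<times> B))"
    by (rule sum.union_inter[symmetric]) auto
  also have "\<dots> = sum ?t (A \<times> A \<union> B \<times> B) + sum ?t ((A \<inter> B) \<times> (A \<inter> B))"
    by (simp add: Times_Int_Times)
  also have "sum ?t (A \<times> A \<union> B \<times> B) \<le> sum ?t ((A \<union> B) \<times> (A \<union> B))"
  proof (rule sum_mono2)
    fix p assume "p \<in> (A \<union> B) \<times> (A \<union> B) - (A \<times> A \<union> B \<times> B)"
    then obtain i j where "p = (i, j)" "i \<in> A \<union> B" "j \<in> A \<union> B" "i \<noteq> j" by auto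
    with nonneg sub show "0 \<le> ?t p" by (auto simp: no_negative_edges_iff)
  qed auto
  finally show ?thesis by (simp add: set_weight_def flip: exp_add)
qed

text \<open>Cross-multiplied, the claim compares products of sums over subsets of \<open>P\<close> and of \<open>S\<close>. Both kinds
  become sums over \<open>Pow S\<close> by cutting off the former with the indicator of \<open>Pow P\<close>. Where the left side
  of the four functions hypothesis is nonzero, \<open>A \<subseteq> P\<close>, so \<open>A \<inter> B\<close> also passes the cut-off, and
  passing from \<open>A\<close> to \<open>A \<union> B\<close> only raises the profit.\<close>

lemma expected_profit_mono:
  assumes nonneg: "no_negative_edges \<theta> S" and r: "\<And>j. 0 \<le> r $ j" and PS: "P \<subseteq> S"
  shows "expected_profit \<theta> r P \<le> expected_profit \<theta> r S"
proof -
  let ?w = "set_weight \<theta>" and ?g = "\<lambda>A. \<Sum>j\<in>A. r $ j"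
  let ?c = "\<lambda>A. if A \<subseteq> P then 1 else 0 :: real"
  have w: "0 \<le> ?w A" for A using set_weight_pos[of \<theta> A] by simp
  have g: "0 \<le> ?g A" for A using r by (simp add: sum_nonneg)
  have cut: "(\<Sum>A\<in>Pow S. ?c A * f A) = (\<Sum>A\<in>Pow P. f A)" for f :: "'a set \<Rightarrow> real"
    by (rule sum.mono_neutral_cong_right) (use PS in auto)
  have "(\<Sum>A\<in>Pow S. ?c A * (?w A * ?g A)) * (\<Sum>A\<in>Pow S. ?w A)
      \<le> (\<Sum>A\<in>Pow S. ?w A * ?g A) * (\<Sum>A\<in>Pow S. ?c A * ?w A)"
  proof (rule four_functions)
    fix A B assume AB: "A \<subseteq> S" "B \<subseteq> S"
    show "?c A * (?w A * ?g A) * ?w B \<le> ?w (A \<union> B) * ?g (A \<union> B) * (?c (A \<inter> B) * ?w (A \<inter> B))"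
    proof (cases "A \<subseteq> P")
      case True
      have "?g A \<le> ?g (A \<union> B)" using r by (intro sum_mono2) auto
      then have "?w A * ?w B * ?g A \<le> ?w (A \<union> B) * ?w (A \<inter> B) * ?g (A \<union> B)"
        using w g by (intro mult_mono[OF set_weight_log_supermodular[OF nonneg AB]]) auto
      moreover have "A \<inter> B \<subseteq> P" using True by auto
      ultimately show ?thesis using True by (simp add: mult_ac)
    next
      case False
      then show ?thesis using w g by simp
    qed
  qed (use w g in auto)
  then have "weighted_profit \<theta> r P * partition_function \<theta> S
      \<le> weighted_profit \<theta> r S * partition_function \<theta> P"
    by (simp only: cut weighted_profit_def partition_function_def)
  then show ?thesis
    using partition_function_pos[of \<theta> S] partition_function_pos[of \<theta> P]
    by (simp add: expected_profit_eq frac_le_eq divide_simps mult_ac)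
qed

section \<open>Optimal assortments\<close>

lemma optimal_assortment_exists: "\<exists>T. optimal_assortment \<theta> r T"
proof -
  have "Max (range (expected_profit \<theta> r)) \<in> range (expected_profit \<theta> r)"
    by (rule Max_in) auto
  then obtain T where "expected_profit \<theta> r T = Max (range (expected_profit \<theta> r))" by force
  then have "optimal_assortment \<theta> r T" by (simp add: optimal_assortment_def)
  then show ?thesis by blast
qed

theorem theorem2:
  fixes \<theta> :: "real^'n::finite^'n" and r :: "real^'n" and H :: "'n set"
  assumes "transpose \<theta> = \<theta>"
    and "\<And>j. r $ j \<ge> 0"
    and "isolated_subgraph \<theta> H"
    and "no_negative_edges \<theta> H"
  shows "\<exists>S. optimal_assortment \<theta> r S \<and> H \<subseteq> S"
proof -
  have sym: "\<theta> $ i $ j = \<theta> $ j $ i" for i j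
    using assms(1) by (metis transpose_def vec_lambda_beta)
  have zero: "\<theta> $ i $ j = 0" "\<theta> $ j $ i = 0" if "i \<in> H" "j \<notin> H" for i j
    using assms(3) that sym[of j i] by (auto simp: isolated_subgraph_iff)
  obtain T where T: "optimal_assortment \<theta> r T" using optimal_assortment_exists by blast
  have split: "expected_profit \<theta> r (P \<union> (T - H))
      = expected_profit \<theta> r P + expected_profit \<theta> r (T - H)" if "P \<subseteq> H" for P
    using that by (intro expected_profit_Un) (auto intro: zero)
  have "T = (T \<inter> H) \<union> (T - H)" by auto
  then have "expected_profit \<theta> r T
      = expected_profit \<theta> r (T \<inter> H) + expected_profit \<theta> r (T - H)"
    using split[of "T \<inter> H"] by simp
  also have "\<dots> \<le> expected_profit \<theta> r H + expected_profit \<theta> r (T - H)"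
    using expected_profit_mono[OF assms(4,2), of "T \<inter> H"] by simp
  also have "\<dots> = expected_profit \<theta> r (H \<union> (T - H))"
    using split[of H] by simp
  finally have "optimal_assortment \<theta> r (H \<union> (T - H))"
    using T by (auto simp: optimal_assortment_def intro: order_trans)
  then show ?thesis by blast
qed

end
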